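(* Let $\mathbf{Y}\sim SE_k(\boldsymbol{\mu},\mathbf{\Omega},\boldsymbol{\delta},g^{(k+1)})$. Then there exists a linear transformation $\mathbf{Y}_{\ast}=\mathbf{A}_{\ast}(\mathbf{Y}-\boldsymbol{\mu})$, with $\mathbf{A}_{\ast}$ a $k\times k$ matrix, such that $\mathbf{Y}_{\ast}\sim SE_k(\boldsymbol{0},\mathbf{I}_k,\boldsymbol{\delta}_{\ast},g^{(k+1)})$, where at most one component of the vector $\boldsymbol{\delta}_{\ast}$ is not zero, and $\boldsymbol{\delta}_{\ast}=(\delta_{\ast},0,\dots,0)^{\top}$ with $\delta_{\ast}=\boldsymbol{\delta}^{\top}\mathbf{\Omega}^{-1}\boldsymbol{\delta}$.
   Context: Skew-elliptical distribution: let $\boldsymbol{\mu}\in\mathbb{R}^k$, let $\mathbf{\Omega}$ be a $k\times k$ symmetric positive definite matrix, let $\boldsymbol{\delta}\in\mathbb{R}^k$ with $\boldsymbol{\delta}^{\top}\mathbf{\Omega}^{-1}\boldsymbol{\delta}<1$, and let $g^{(k+1)}$ be a spherical $(k+1)$-dimensional density generator, i.e. a nonnegative function on $[0,\infty)$ such that $\boldsymbol{x}\mapsto g^{(k+1)}(\boldsymbol{x}^{\top}\boldsymbol{x})$ is a probability density on $\mathbb{R}^{k+1}$. One writes $\mathbf{Y}\sim SE_k(\boldsymbol{\mu},\mathbf{\Omega},\boldsymbol{\delta},g^{(k+1)})$ if the random vector $\mathbf{Y}$ in $\mathbb{R}^k$ has density $$f_{\mathbf{Y}}(\boldsymbol{y})=2|\mathbf{\Omega}|^{-1/2}\int_{-\infty}^{\boldsymbol{\alpha}^{\top}(\boldsymbol{y}-\boldsymbol{\mu})}g^{(k+1)}\left(r^2+(\boldsymbol{y}-\boldsymbol{\mu})^{\top}\mathbf{\Omega}^{-1}(\boldsymbol{y}-\boldsymbol{\mu})\right)\mathrm{d}r,\quad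 \boldsymbol{y}\in\mathbb{R}^k,\qquad \boldsymbol{\alpha}^{\top}=\frac{\boldsymbol{\delta}^{\top}\mathbf{\Omega}^{-1}}{(1-\boldsymbol{\delta}^{\top}\mathbf{\Omega}^{-1}\boldsymbol{\delta})^{1/2}}.$$ $\mathbf{I}_k$ is the $k\times k$ identity matrix.
   Formalization: The formula for δ_* is corrected to δ_* = (δ^T Ω^{-1} δ)^{1/2}; the printed value without the square root fails, e.g. for k=1, Ω=1, 0<δ<1 and the Gaussian generator, where δ_* must be ±δ and not δ². *)

theory Defs
  imports "HOL-Probability.Probability"
begin

definition symmetric_pos_def :: "real^'n^'n \<Rightarrow> bool" where
  "symmetric_pos_def A \<longleftrightarrow> transpose A = A \<and> (\<forall>x. x \<noteq> 0 \<longrightarrow> 0 < x \<bullet> (A *v x))"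

text \<open>
  Spherical density generator on the Euclidean space of the type argument. Only the values of
  \<open>g\<close> on the nonnegative reals matter.
\<close>
definition density_generator :: "'e::euclidean_space itself \<Rightarrow> (real \<Rightarrow> real) \<Rightarrow> bool" where
  "density_generator _ g \<longleftrightarrow>
     (\<forall>t\<ge>0. 0 \<le> g t) \<and>
     (\<lambda>x::'e. g (x \<bullet> x)) \<in> borel_measurable borel \<and>
     (\<integral>\<^sup>+x. ennreal (g (x \<bullet> x)) \<partial>(lborel :: 'e measure)) = 1"

definition se_alpha :: "real^'k^'k \<Rightarrow> real^'k \<Rightarrow> real^'k" where
  "se_alpha \<Omega> \<delta> =
     (1 / sqrt (1 - \<delta> \<bullet> (matrix_inv \<Omega> *v \<delta>))) *\<^sub>R (\<delta> v* matrix_inv \<Omega>)"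

text \<open>
  The integral is taken in the extended nonnegative reals, since for an unbounded generator it may
  diverge on a null set of points \<open>y\<close>.
\<close>
definition se_density ::
    "real^'k \<Rightarrow> real^'k^'k \<Rightarrow> real^'k \<Rightarrow> (real \<Rightarrow> real) \<Rightarrow> real^'k \<Rightarrow> ennreal" where
  "se_density \<mu> \<Omega> \<delta> g y =
     ennreal (2 * det \<Omega> powr (- 1 / 2)) *
     (\<integral>\<^sup>+r\<in>{..se_alpha \<Omega> \<delta> \<bullet> (y - \<mu>)}.
        ennreal (g (r\<^sup>2 + (y - \<mu>) \<bullet> (matrix_inv \<Omega> *v (y - \<mu>)))) \<partial>lborel)"

text \<open>
  The type \<open>(real^'k) \<times> real\<close> is the Euclidean space of dimension \<open>k + 1\<close>, with
  \<open>(x, r) \<bullet> (x, r) = x \<bullet> x + r\<^sup>2\<close>.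
\<close>
definition skew_elliptical ::
    "'a measure \<Rightarrow> ('a \<Rightarrow> real^'k) \<Rightarrow> real^'k \<Rightarrow> real^'k^'k \<Rightarrow> real^'k \<Rightarrow> (real \<Rightarrow> real) \<Rightarrow> bool" where
  "skew_elliptical M Y \<mu> \<Omega> \<delta> g \<longleftrightarrow>
     symmetric_pos_def \<Omega> \<and>
     \<delta> \<bullet> (matrix_inv \<Omega> *v \<delta>) < 1 \<and>
     density_generator TYPE((real^'k) \<times> real) g \<and>
     distributed M lborel Y (se_density \<mu> \<Omega> \<delta> g)"

end

theory Submission
  imports Defs
begin

text \<open>
  Write \<open>P = \<Omega>\<inverse>\<close> and \<open>s\<^sup>2 = \<delta> \<bullet> (P *v \<delta>)\<close>. The density of \<open>Y\<close> at \<open>y\<close> depends on \<open>y - \<mu>\<close> only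
  through the form \<open>x, y \<mapsto> x \<bullet> (P *v y)\<close>: once through the quadratic form of \<open>y - \<mu>\<close>, and once
  through the form of \<open>\<delta>\<close> and \<open>y - \<mu>\<close>, which is \<open>\<alpha> \<bullet> (y - \<mu>)\<close> up to a factor that depends on
  \<open>s\<close> alone. Let \<open>A\<close> be a linear isometry from this form to the standard inner product; then the
  density of \<open>Y\<close> is a constant times the standard skew-elliptical density with parameter
  \<open>A *v \<delta>\<close>, evaluated at \<open>A *v (y - \<mu>)\<close> (\<open>se_density_isometry\<close>, \<open>se_density_standard\<close>). A
  Gram-Schmidt argument that begins with \<open>\<delta>\<close> normalised gives an isometry that maps \<open>\<delta>\<close> to \<open>s\<close>
  times the unit vector of the chosen coordinate (\<open>form_isometry_to_standard\<close>).

  What remains is to transport the law along \<open>y \<mapsto> A *v (y - \<mu>)\<close>, and this needs no determinant.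
  The image of Lebesgue measure under an invertible affine map is translation invariant, hence a
  constant multiple of Lebesgue measure (\<open>translation_invariant_imp_scaled_lborel\<close>,
  \<open>distr_lborel_affine_matrix\<close>). So the transformed vector has a density that is a constant
  multiple of the standard one. Both integrate to 1: the former because it is a law, the latter
  because the point reflection of the space of pairs \<open>(z, r)\<close> exchanges the two half spaces
  \<open>r \<le> a \<bullet> z\<close> and \<open>r \<ge> a \<bullet> z\<close>, so that each carries mass 1/2
  (\<open>nn_integral_half_line_mass\<close>). Hence the constant is 1, which replaces the identity
  \<open>\<bar>det A\<bar> = det \<Omega> powr (- 1 / 2)\<close>.
\<close>

section \<open>Lebesgue measure under affine maps\<close>

lemma nn_integral_lborel_signed_shift:
  fixes h :: "'a::euclidean_space \<Rightarrow> ennreal"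
  assumes [measurable]: "h \<in> borel_measurable borel" and "\<bar>c\<bar> = 1"
  shows "(\<integral>\<^sup>+x. h x \<partial>lborel) = (\<integral>\<^sup>+x. h (a + c *\<^sub>R x) \<partial>lborel)"
proof -
  have "c \<noteq> 0" using assms by auto
  have "(\<integral>\<^sup>+x. h x \<partial>lborel)
      = (\<integral>\<^sup>+x. h x \<partial>density (distr lborel borel (\<lambda>x. a + c *\<^sub>R x)) (\<lambda>_. \<bar>c\<bar> ^ DIM('a)))"
    by (subst lborel_affine[OF \<open>c \<noteq> 0\<close>, of a]) (rule refl)
  also have "\<dots> = (\<integral>\<^sup>+x. h (a + c *\<^sub>R x) \<partial>lborel)"
    by (simp add: \<open>\<bar>c\<bar> = 1\<close> density_1 nn_integral_distr)
  finally show ?thesis .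
qed

text \<open>
  Uniqueness of Haar measure on Euclidean space. With \<open>F\<close> the unit cube and \<open>\<lambda>\<close> Lebesgue measure,
  compute the mass of \<open>E \<times> F\<close> under the product of \<open>N\<close> and \<open>\<lambda>\<close> in two ways: shearing first along
  \<open>\<lambda>\<close> and then along \<open>N\<close> exchanges the roles of \<open>E\<close> and \<open>F\<close>, up to a reflection of \<open>E\<close> that
  \<open>\<lambda>\<close> ignores, and so \<open>N E * \<lambda> F = N F * \<lambda> E\<close>.
\<close>

lemma translation_invariant_imp_scaled_lborel:
  fixes N :: "'a::euclidean_space measure"
  assumes sf: "sigma_finite_measure N" and sets_N[measurable_cong]: "sets N = sets borel"
    and inv: "\<And>a. distr N borel ((+) a) = N"
  shows "N = density lborel (\<lambda>_. emeasure N (box 0 One))"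
proof (rule measure_eqI)
  show "sets N = sets (density lborel (\<lambda>_. emeasure N (box 0 One)))"
    by (simp add: sets_N)
next
  fix E assume "E \<in> sets N"
  then have E[measurable]: "E \<in> sets borel" by (simp add: sets_N)
  interpret N: sigma_finite_measure N by fact
  interpret pair_sigma_finite N "lborel :: 'a measure" ..
  let ?F = "box 0 One :: 'a set"
  let ?e = "indicator E :: 'a \<Rightarrow> ennreal" and ?f = "indicator ?F :: 'a \<Rightarrow> ennreal"
  have shift_N: "(\<integral>\<^sup>+x. h x \<partial>N) = (\<integral>\<^sup>+x. h (a + x) \<partial>N)"
    if [measurable]: "h \<in> borel_measurable borel" for h :: "'a \<Rightarrow> ennreal" and a
  proof -
    have "(\<integral>\<^sup>+x. h x \<partial>distr N borel ((+) a)) = (\<integral>\<^sup>+x. h (a + x) \<partial>N)"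
      by (rule nn_integral_distr) simp_all
    then show ?thesis by (simp only: inv)
  qed
  have F1: "emeasure lborel ?F = 1"
    by (simp add: emeasure_lborel_box_eq inner_Basis)
  have "emeasure N E = (\<integral>\<^sup>+x. ?e x * emeasure lborel ?F \<partial>N)"
    by (simp add: F1 sets_N)
  also have "\<dots> = (\<integral>\<^sup>+x. \<integral>\<^sup>+y. ?e x * ?f y \<partial>lborel \<partial>N)"
    by (simp add: nn_integral_cmult)
  \<comment> \<open>the shear along \<open>\<lambda>\<close>: replace \<open>y\<close> by \<open>x + y\<close> for fixed \<open>x\<close>\<close>
  also have "\<dots> = (\<integral>\<^sup>+x. \<integral>\<^sup>+y. ?e x * ?f (x + y) \<partial>lborel \<partial>N)"
    by (rule nn_integral_cong, subst nn_integral_lborel_signed_shift[of _ 1]) simp_all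
  also have "\<dots> = (\<integral>\<^sup>+y. \<integral>\<^sup>+x. ?e x * ?f (x + y) \<partial>N \<partial>lborel)"
    by (rule Fubini'[symmetric]) measurable
  \<comment> \<open>the shear along \<open>N\<close>: replace \<open>x\<close> by \<open>x - y\<close> for fixed \<open>y\<close>\<close>
  also have "\<dots> = (\<integral>\<^sup>+y. \<integral>\<^sup>+x. ?e (x - y) * ?f x \<partial>N \<partial>lborel)"
  proof (rule nn_integral_cong)
    fix y
    show "(\<integral>\<^sup>+x. ?e x * ?f (x + y) \<partial>N) = (\<integral>\<^sup>+x. ?e (x - y) * ?f x \<partial>N)"
      by (subst shift_N[of _ "- y"]) simp_all
  qed
  also have "\<dots> = (\<integral>\<^sup>+x. \<integral>\<^sup>+y. ?e (x - y) * ?f x \<partial>lborel \<partial>N)"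
    by (rule Fubini') measurable
  \<comment> \<open>Lebesgue measure is invariant under \<open>y \<mapsto> x - y\<close>\<close>
  also have "\<dots> = (\<integral>\<^sup>+x. \<integral>\<^sup>+y. ?e y * ?f x \<partial>lborel \<partial>N)"
    by (rule nn_integral_cong, subst (2) nn_integral_lborel_signed_shift[of _ "-1"]) simp_all
  also have "\<dots> = (\<integral>\<^sup>+x. emeasure lborel E * ?f x \<partial>N)"
    by (simp add: nn_integral_multc)
  also have "\<dots> = emeasure lborel E * emeasure N ?F"
    by (simp add: nn_integral_cmult sets_N)
  also have "\<dots> = emeasure (density lborel (\<lambda>_. emeasure N ?F)) E"
    by (subst mult.commute) (simp add: emeasure_density nn_integral_cmult_indicator)
  finally show "emeasure N E = emeasure (density lborel (\<lambda>_. emeasure N (box 0 One))) E" .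
qed

text \<open>
  The value of \<open>c\<close> is left open on purpose; it will follow from comparing total masses.
\<close>

lemma distr_lborel_affine_matrix:
  fixes A :: "real^'k^'k" and b :: "real^'k"
  assumes "invertible A"
  obtains c where "distr lborel borel (\<lambda>y. A *v (y - b)) = density lborel (\<lambda>_. c)"
proof -
  obtain B where AB: "A ** B = mat 1" and BA: "B ** A = mat 1"
    using assms by (auto simp: invertible_def)
  let ?T = "\<lambda>y. A *v (y - b)" and ?S = "\<lambda>z. B *v z + b"
  have cont: "continuous_on UNIV ((*v) M)" for M :: "real^'k^'k"
    by (simp add: linear_continuous_on matrix_vector_mul_bounded_linear)
  have [measurable]: "(*v) M \<in> borel_measurable borel" for M :: "real^'k^'k"
    using cont by (rule borel_measurable_continuous_onI)
  have TS: "?T (?S z) = z" and ST: "?S (?T y) = y" for y z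
    by (simp_all add: matrix_vector_mul_assoc AB BA)
  let ?N = "distr lborel borel ?T"
  \<comment> \<open>pulling back along the inverse map \<open>?S\<close> transfers sigma-finiteness from \<open>lborel\<close> to \<open>?N\<close>\<close>
  have "distr ?N borel ?S = lborel"
    by (subst distr_distr) (simp_all add: o_def ST distr_id2)
  then have "sigma_finite_measure (distr ?N borel ?S)"
    using sigma_finite_lborel by simp
  then have "sigma_finite_measure ?N"
    by (rule sigma_finite_measure_distr) simp
  moreover have "distr ?N borel ((+) a) = ?N" for a
  proof -
    have "distr ?N borel ((+) a) = distr lborel borel (\<lambda>y. ?T (B *v a + y))"
      by (subst distr_distr)
        (simp_all add: o_def matrix_vector_right_distrib matrix_vector_mult_diff_distrib
          matrix_vector_mul_assoc AB add_diff_eq)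
    also have "\<dots> = distr (distr lborel borel ((+) (B *v a))) borel ?T"
      by (subst distr_distr) (simp_all add: o_def)
    also have "\<dots> = ?N"
      by (simp add: lborel_distr_plus)
    finally show ?thesis .
  qed
  ultimately show ?thesis
    using translation_invariant_imp_scaled_lborel[of ?N] that by simp
qed

section \<open>Isometries from a positive definite form to the standard inner product\<close>

lemma matrix_inv_works:
  fixes A :: "real^'k^'k"
  assumes "invertible A"
  shows "A ** matrix_inv A = mat 1" "matrix_inv A ** A = mat 1"
  using someI_ex[OF assms[unfolded invertible_def]] by (simp_all add: matrix_inv_def)

lemma matrix_inv_mat_1: "matrix_inv (mat 1 :: real^'k^'k) = mat 1"
  using matrix_inv_works(1)[of "mat 1 :: real^'k^'k"]
  by (simp add: invertible_def)

lemma symmetric_pos_def_mat_1: "symmetric_pos_def (mat 1 :: real^'k^'k)"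
  by (simp add: symmetric_pos_def_def transpose_mat)

lemma symmetric_pos_def_matrix_inv:
  fixes \<Omega> :: "real^'k^'k"
  assumes "symmetric_pos_def \<Omega>"
  shows "symmetric_pos_def (matrix_inv \<Omega>)"
proof -
  have sym: "transpose \<Omega> = \<Omega>" and pos: "\<And>x. x \<noteq> 0 \<Longrightarrow> 0 < x \<bullet> (\<Omega> *v x)"
    using assms by (auto simp: symmetric_pos_def_def)
  have "\<exists>B. B ** \<Omega> = mat 1"
    unfolding matrix_left_invertible_ker
    by (metis inner_zero_right less_irrefl pos)
  then have inv: "invertible \<Omega>"
    by (simp add: invertible_left_inverse)
  note W = matrix_inv_works[OF inv]
  have "transpose (matrix_inv \<Omega>) ** \<Omega> = mat 1"
    by (metis W(1) matrix_transpose_mul sym transpose_mat)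
  then have T: "transpose (matrix_inv \<Omega>) = matrix_inv \<Omega>"
    by (metis W(1) matrix_mul_assoc matrix_mul_lid matrix_mul_rid)
  have "0 < x \<bullet> (matrix_inv \<Omega> *v x)" if "x \<noteq> 0" for x
  proof -
    let ?u = "matrix_inv \<Omega> *v x"
    have x: "\<Omega> *v ?u = x"
      by (simp add: matrix_vector_mul_assoc W)
    with that have "?u \<noteq> 0" by auto
    from pos[OF this] show ?thesis by (simp add: x inner_commute)
  qed
  with T show ?thesis by (simp add: symmetric_pos_def_def)
qed

lemma symmetric_matrix_inner_commute:
  fixes P :: "real^'k^'k"
  assumes "transpose P = P"
  shows "x \<bullet> (P *v y) = y \<bullet> (P *v x)"
  by (metis assms dot_lmul_matrix inner_commute transpose_matrix_vector)

text \<open>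
  Gram-Schmidt by maximality: among the finite \<open>P\<close>-orthonormal sets that contain \<open>v\<close>, whose size is
  bounded because they are independent, take one of greatest size. If it did not span, the
  normalised residue of a vector outside its span could be added.
\<close>

lemma form_orthonormal_basis_extending:
  fixes P :: "real^'k^'k" and v :: "real^'k"
  assumes P: "symmetric_pos_def P" and v: "v \<bullet> (P *v v) = 1"
  obtains f :: "'k \<Rightarrow> real^'k"
  where "f first = v" "\<And>i j. f i \<bullet> (P *v f j) = of_bool (i = j)"
proof -
  have sym: "\<And>x y. x \<bullet> (P *v y) = y \<bullet> (P *v x)" and pos: "\<And>x. x \<noteq> 0 \<Longrightarrow> 0 < x \<bullet> (P *v x)"
    using P symmetric_matrix_inner_commute[of P] by (auto simp: symmetric_pos_def_def)
  define ON where "ON S \<longleftrightarrow> finite S \<and> v \<in> S \<and> (\<forall>x\<in>S. \<forall>y\<in>S. x \<bullet> (P *v y) = of_bool (x = y))"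
    for S
  have coeff: "(\<Sum>s\<in>S. u s *\<^sub>R s) \<bullet> (P *v t) = u t" if S: "ON S" "t \<in> S" for S u t
  proof -
    have "(\<Sum>s\<in>S. u s *\<^sub>R s) \<bullet> (P *v t) = (\<Sum>s\<in>S. if s = t then u s else 0)"
      unfolding inner_sum_left using S by (intro sum.cong) (auto simp: ON_def)
    then show ?thesis using S by (simp add: ON_def)
  qed
  have indep: "independent S" if S: "ON S" for S
  proof -
    have "finite S" using S by (simp add: ON_def)
    moreover have "u t = 0" if "(\<Sum>s\<in>S. u s *\<^sub>R s) = 0" "t \<in> S" for u t
      using coeff[OF S that(2), of u] that(1) by simp
    ultimately show ?thesis
      by (auto simp: dependent_finite)
  qed
  have bound: "card S \<le> CARD('k)" if "ON S" for S
    using independent_bound[OF indep[OF that]] by simp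
  have "ON {v}" using v by (simp add: ON_def)
  then obtain S where S: "ON S" and max: "\<And>S'. ON S' \<Longrightarrow> card S' \<le> card S"
    using ex_has_greatest_nat[of ON "{v}" card "Suc CARD('k)"] bound
    by (metis le_imp_less_Suc)
  have fin: "finite S" using S by (simp add: ON_def)
  have "x \<in> span S" for x
  proof (rule ccontr)
    assume x: "x \<notin> span S"
    define w where "w = x - (\<Sum>s\<in>S. (x \<bullet> (P *v s)) *\<^sub>R s)"
    have "w \<noteq> 0"
    proof
      assume "w = 0"
      then have "x = (\<Sum>s\<in>S. (x \<bullet> (P *v s)) *\<^sub>R s)" by (simp add: w_def)
      also have "\<dots> \<in> span S" by (intro span_sum span_scale span_base)
      finally show False using x by simp
    qed
    have orth: "w \<bullet> (P *v t) = 0" if "t \<in> S" for t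
      using coeff[OF S that, of "\<lambda>s. x \<bullet> (P *v s)"] by (simp add: w_def inner_diff_left)
    define q where "q = sqrt (w \<bullet> (P *v w))"
    have q: "q > 0" "q * q = w \<bullet> (P *v w)"
      using pos[OF \<open>w \<noteq> 0\<close>] by (auto simp: q_def)
    define w' where "w' = (1 / q) *\<^sub>R w"
    have w': "w' \<bullet> (P *v w') = 1"
      using q(1) by (simp add: w'_def matrix_vector_mult_scaleR flip: q(2))
    have orth': "w' \<bullet> (P *v t) = 0" "t \<bullet> (P *v w') = 0" if "t \<in> S" for t
      using orth[OF that] sym[of t] by (simp_all add: w'_def)
    have new: "w' \<notin> S"
      using w' orth'(1) by force
    have "ON (insert w' S)"
      using S w' orth' new by (auto simp: ON_def)
    from max[OF this] show False
      using new fin by simp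
  qed
  then have "span S = UNIV" by blast
  then have "card S = CARD('k)"
    using indep[OF S] by (metis dim_UNIV dim_eq_card_independent dim_span DIM_cart DIM_real mult.right_neutral)
  moreover obtain h where h: "bij_betw h (UNIV :: 'k set) S"
    using calculation fin by (metis bij_betw_iff_card finite_class.finite_UNIV)
  obtain j where j: "h j = v"
    using h S by (auto simp: ON_def bij_betw_def)
  \<comment> \<open>relabel the basis so that the prescribed vector gets the index \<open>first\<close>\<close>
  define f where "f = h \<circ> Transposition.transpose first j"
  have "inj h" using h by (simp add: bij_betw_def)
  then have injf: "inj f"
    unfolding f_def by (intro inj_compose inj_transpose)
  have "f i \<in> S" for i
    using h by (auto simp: f_def bij_betw_def)
  then have "f i \<bullet> (P *v f j) = of_bool (i = j)" for i j
    using S injf by (auto simp: ON_def inj_eq)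
  moreover have "f first = v" by (simp add: f_def j)
  ultimately show ?thesis using that by blast
qed

text \<open>
  The isometry is the coordinate map of a \<open>P\<close>-orthonormal basis: Parseval's identity says that it
  carries the form of \<open>P\<close> to the standard inner product.
\<close>

lemma form_isometry_to_standard:
  fixes P :: "real^'k^'k" and v :: "real^'k"
  assumes P: "symmetric_pos_def P" and v: "v \<bullet> (P *v v) = 1"
  obtains A :: "real^'k^'k"
  where "invertible A" "\<And>x y. (A *v x) \<bullet> (A *v y) = x \<bullet> (P *v y)" "A *v v = axis first 1"
proof -
  obtain f :: "'k \<Rightarrow> real^'k"
    where fv: "f first = v" and f: "\<And>i j. f i \<bullet> (P *v f j) = of_bool (i = j)"
    using form_orthonormal_basis_extending[OF P v] by metis
  have sym: "\<And>x y. x \<bullet> (P *v y) = y \<bullet> (P *v x)"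
    using P symmetric_matrix_inner_commute[of P] by (auto simp: symmetric_pos_def_def)
  define A :: "real^'k^'k" where "A = (\<chi> i. P *v f i)"
  define F :: "real^'k^'k" where "F = (\<chi> j i. f i $ j)"
  have A: "(A *v x) $ i = f i \<bullet> (P *v x)" for x i
    using sym[of x "f i"] by (simp add: A_def matrix_vector_mul_component inner_commute)
  have F: "F *v c = (\<Sum>i\<in>UNIV. c $ i *\<^sub>R f i)" for c
    by (simp add: F_def matrix_vector_mult_def vec_eq_iff mult.commute)
  have Af: "A *v f j = axis j 1" for j
    by (auto simp: vec_eq_iff A f axis_def)
  have "(A ** F) $ i $ j = (A *v f j) $ i" for i j
    by (simp add: F_def matrix_matrix_mult_def matrix_vector_mult_def)
  then have "A ** F = mat 1"
    by (simp add: vec_eq_iff Af mat_def axis_def)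
  then have FA: "F ** A = mat 1"
    by (simp add: matrix_left_right_inverse)
  have "(A *v x) \<bullet> (A *v y) = x \<bullet> (P *v y)" for x y
  proof -
    have "x = F *v (A *v x)" by (simp add: matrix_vector_mul_assoc FA)
    then have "x \<bullet> (P *v y) = (\<Sum>i\<in>UNIV. (A *v x) $ i *\<^sub>R f i) \<bullet> (P *v y)"
      by (simp add: F)
    also have "\<dots> = (A *v x) \<bullet> (A *v y)"
      by (simp add: inner_sum_left inner_vec_def[of "A *v x" "A *v y"] A)
    finally show ?thesis by simp
  qed
  moreover have "invertible A"
    using FA invertible_left_inverse by blast
  ultimately show ?thesis
    using that Af[of first] fv by simp
qed

text \<open>
  Normalises \<open>\<delta>\<close>, and covers \<open>\<delta> = 0\<close> with an arbitrary unit vector, so that the main proof needs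
  no case distinction.
\<close>

lemma exists_form_unit_vector:
  fixes P :: "real^'k^'k" and \<delta> :: "real^'k"
  assumes P: "symmetric_pos_def P"
  obtains v where "v \<bullet> (P *v v) = 1" "\<delta> = sqrt (\<delta> \<bullet> (P *v \<delta>)) *\<^sub>R v"
proof -
  have pos: "\<And>x. x \<noteq> 0 \<Longrightarrow> 0 < x \<bullet> (P *v x)"
    using P by (auto simp: symmetric_pos_def_def)
  obtain x where "x \<noteq> 0" and x: "\<delta> = 0 \<or> x = \<delta>"
  proof (cases "\<delta> = 0")
    case True
    then show ?thesis
      using that[of "axis undefined 1"] by (simp add: axis_eq_0_iff)
  qed (use that in auto)
  define q where "q = sqrt (x \<bullet> (P *v x))"
  have q: "q > 0" "q * q = x \<bullet> (P *v x)"
    using pos[OF \<open>x \<noteq> 0\<close>] by (auto simp: q_def)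
  show ?thesis
  proof
    show "((1 / q) *\<^sub>R x) \<bullet> (P *v ((1 / q) *\<^sub>R x)) = 1"
      using q(1) by (simp add: matrix_vector_mult_scaleR flip: q(2))
    show "\<delta> = sqrt (\<delta> \<bullet> (P *v \<delta>)) *\<^sub>R (1 / q) *\<^sub>R x"
      using x q by (auto simp: q_def)
  qed
qed

section \<open>The standard skew-elliptical density\<close>

text \<open>
  The standard skew-elliptical density without its factor 2, for the slope vector \<open>a\<close> in the role
  of \<open>\<alpha>\<close>.
\<close>

definition half_line_mass ::
    "(real \<Rightarrow> real) \<Rightarrow> 'e::euclidean_space \<Rightarrow> 'e \<Rightarrow> ennreal" where
  "half_line_mass g a z = (\<integral>\<^sup>+r\<in>{..a \<bullet> z}. ennreal (g (r\<^sup>2 + z \<bullet> z)) \<partial>lborel)"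

text \<open>
  The spherical density on the pairs \<open>(z, r)\<close> is even, so the half spaces \<open>r \<le> a \<bullet> z\<close> and
  \<open>r \<ge> a \<bullet> z\<close> have equal mass. They cover the space, and they overlap in a null set because for
  each \<open>z\<close> they share the single value \<open>r = a \<bullet> z\<close>. Thus each has mass 1/2.
\<close>

lemma
  fixes a :: "'e::euclidean_space"
  assumes g: "density_generator TYPE('e \<times> real) g"
  shows borel_measurable_half_line_mass: "half_line_mass g a \<in> borel_measurable borel"
    and nn_integral_half_line_mass: "(\<integral>\<^sup>+z. 2 * half_line_mass g a z \<partial>lborel) = 1"
proof -
  have g_borel: "(\<lambda>x::'e \<times> real. g (x \<bullet> x)) \<in> borel_measurable borel"
    and g_mass: "(\<integral>\<^sup>+x. ennreal (g (x \<bullet> x)) \<partial>(lborel :: ('e \<times> real) measure)) = 1"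
    using g by (auto simp: density_generator_def)
  define G :: "'e \<Rightarrow> real \<Rightarrow> ennreal" where "G z r = ennreal (g (r\<^sup>2 + z \<bullet> z))" for z r
  have "(\<lambda>x::'e \<times> real. ennreal (g (x \<bullet> x))) \<in> borel_measurable (borel \<Otimes>\<^sub>M borel)"
    using g_borel by (subst borel_prod) measurable
  then have G[measurable]: "(\<lambda>(z, r). G z r) \<in> borel_measurable (borel \<Otimes>\<^sub>M borel)"
    by (simp add: G_def case_prod_unfold inner_prod_def power2_eq_square add.commute)
  define L where "L z = (\<integral>\<^sup>+r. G z r * indicator {..a \<bullet> z} r \<partial>lborel)" for z
  define R where "R z = (\<integral>\<^sup>+r. G z r * indicator {a \<bullet> z..} r \<partial>lborel)" for z
  have L: "half_line_mass g a = L"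
    by (simp add: fun_eq_iff half_line_mass_def L_def G_def)
  have [measurable]: "(\<lambda>(z, r). indicator {..a \<bullet> z} r :: ennreal) \<in> borel_measurable (borel \<Otimes>\<^sub>M borel)"
    "(\<lambda>(z, r). indicator {a \<bullet> z..} r :: ennreal) \<in> borel_measurable (borel \<Otimes>\<^sub>M borel)"
    unfolding indicator_def atMost_iff atLeast_iff by measurable
  have mL[measurable]: "L \<in> borel_measurable borel" and [measurable]: "R \<in> borel_measurable borel"
    unfolding L_def R_def by measurable
  then show "half_line_mass g a \<in> borel_measurable borel" by (simp add: L)
  have neg: "(\<integral>\<^sup>+x. h x \<partial>lborel) = (\<integral>\<^sup>+x. h (- x) \<partial>lborel)"
    if "h \<in> borel_measurable borel" for h :: "'b::euclidean_space \<Rightarrow> ennreal"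
    using nn_integral_lborel_signed_shift[OF that, of "-1" 0] by simp
  have "L (- z) = R z" for z
  proof -
    have "L (- z) = (\<integral>\<^sup>+r. G (- z) (- r) * indicator {..a \<bullet> (- z)} (- r) \<partial>lborel)"
      unfolding L_def by (rule neg) measurable
    also have "\<dots> = R z"
      unfolding R_def G_def by (intro nn_integral_cong) (auto simp: indicator_def)
    finally show ?thesis .
  qed
  then have LR: "(\<integral>\<^sup>+z. L z \<partial>lborel) = (\<integral>\<^sup>+z. R z \<partial>lborel)"
    using neg[OF mL] by simp
  have "L z + R z = (\<integral>\<^sup>+r. G z r \<partial>lborel)" for z
  proof -
    have "L z + R z = (\<integral>\<^sup>+r. G z r * indicator {..a \<bullet> z} r + G z r * indicator {a \<bullet> z..} r \<partial>lborel)"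
      unfolding L_def R_def by (rule nn_integral_add[symmetric]) measurable
    also have "\<dots> = (\<integral>\<^sup>+r. G z r \<partial>lborel)"
      by (rule nn_integral_cong_AE, rule AE_mp[OF AE_lborel_singleton[of "a \<bullet> z"]])
         (auto simp: indicator_def)
    finally show ?thesis .
  qed
  then have "(\<integral>\<^sup>+z. L z \<partial>lborel) + (\<integral>\<^sup>+z. R z \<partial>lborel) = (\<integral>\<^sup>+z. \<integral>\<^sup>+r. G z r \<partial>lborel \<partial>lborel)"
    by (subst nn_integral_add[symmetric]) simp_all
  also have "\<dots> = (\<integral>\<^sup>+x. (case x of (z, r) \<Rightarrow> G z r) \<partial>(lborel \<Otimes>\<^sub>M lborel))"
    by (subst lborel.nn_integral_fst[symmetric]) simp_all
  also have "\<dots> = 1"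
    using g_mass
    by (simp add: lborel_prod G_def case_prod_unfold inner_prod_def power2_eq_square add.commute)
  finally show "(\<integral>\<^sup>+z. 2 * half_line_mass g a z \<partial>lborel) = 1"
    by (simp add: L LR[symmetric] nn_integral_add mult_2)
qed

text \<open>
  Eliminates \<open>\<alpha>\<close>, to show that \<open>\<delta>\<close> and \<open>y - \<mu>\<close> enter only through the form of \<open>matrix_inv \<Omega>\<close>.
\<close>

lemma se_density_alt:
  "se_density \<mu> \<Omega> \<delta> g y =
    ennreal (2 * det \<Omega> powr (- 1 / 2)) *
     (\<integral>\<^sup>+r\<in>{..(\<delta> \<bullet> (matrix_inv \<Omega> *v (y - \<mu>))) / sqrt (1 - \<delta> \<bullet> (matrix_inv \<Omega> *v \<delta>))}.
        ennreal (g (r\<^sup>2 + (y - \<mu>) \<bullet> (matrix_inv \<Omega> *v (y - \<mu>)))) \<partial>lborel)"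
  by (simp add: se_density_def se_alpha_def dot_lmul_matrix)

lemma se_density_isometry:
  fixes A \<Omega> :: "real^'k^'k"
  assumes "\<And>x y. (A *v x) \<bullet> (A *v y) = x \<bullet> (matrix_inv \<Omega> *v y)"
  shows "se_density \<mu> \<Omega> \<delta> g y = ennreal (2 * det \<Omega> powr (- 1 / 2)) *
    half_line_mass g (se_alpha (mat 1) (A *v \<delta>)) (A *v (y - \<mu>))"
  by (simp add: se_density_alt half_line_mass_def se_alpha_def dot_lmul_matrix matrix_inv_mat_1 assms)

lemma se_density_standard:
  "se_density 0 (mat 1) \<delta> g z = 2 * half_line_mass g (se_alpha (mat 1) \<delta>) z"
  by (simp add: se_density_def half_line_mass_def matrix_inv_mat_1)

section \<open>Canonical form of a skew-elliptical vector\<close>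

theorem theorem1:
  fixes M :: "'a measure"
    and Y :: "'a \<Rightarrow> real^'k"
    and \<mu> \<delta> :: "real^'k"
    and \<Omega> :: "real^'k^'k"
    and g :: "real \<Rightarrow> real"
    and first :: 'k
  assumes "prob_space M"
    and "skew_elliptical M Y \<mu> \<Omega> \<delta> g"
  shows "\<exists>(A :: real^'k^'k) (\<delta>' :: real^'k).
           skew_elliptical M (\<lambda>\<omega>. A *v (Y \<omega> - \<mu>)) 0 (mat 1) \<delta>' g \<and>
           card {j. \<delta>' $ j \<noteq> 0} \<le> 1 \<and>
           \<delta>' = axis first (sqrt (\<delta> \<bullet> (matrix_inv \<Omega> *v \<delta>)))"
proof -
  interpret prob_space M by fact
  let ?P = "matrix_inv \<Omega>"
  have \<Omega>: "symmetric_pos_def \<Omega>" and \<delta>: "\<delta> \<bullet> (?P *v \<delta>) < 1"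
    and g: "density_generator TYPE((real^'k) \<times> real) g"
    and Y: "distributed M lborel Y (se_density \<mu> \<Omega> \<delta> g)"
    using assms(2) by (auto simp: skew_elliptical_def)
  have P: "symmetric_pos_def ?P"
    using \<Omega> by (rule symmetric_pos_def_matrix_inv)
  define s where "s = sqrt (\<delta> \<bullet> (?P *v \<delta>))"
  obtain v where v: "v \<bullet> (?P *v v) = 1" "\<delta> = s *\<^sub>R v"
    using exists_form_unit_vector[OF P] unfolding s_def by metis
  obtain A where A: "invertible A" and iso: "\<And>x y. (A *v x) \<bullet> (A *v y) = x \<bullet> (?P *v y)"
    and Av: "A *v v = axis first 1"
    using form_isometry_to_standard[OF P v(1)] by metis
  have A\<delta>: "A *v \<delta> = axis first s"
    unfolding v(2) matrix_vector_mult_scaleR Av by (simp add: vec_eq_iff axis_def)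
  let ?\<delta> = "A *v \<delta>"
  let ?T = "\<lambda>y. A *v (y - \<mu>)"
  let ?h = "half_line_mass g (se_alpha (mat 1) ?\<delta>)"
  let ?K = "ennreal (2 * det \<Omega> powr (- 1 / 2))"
  obtain c where c: "distr lborel borel ?T = density lborel (\<lambda>_. c)"
    using distr_lborel_affine_matrix[OF A] by metis
  note h[measurable] = borel_measurable_half_line_mass[OF g, of "se_alpha (mat 1) ?\<delta>"]
  have "continuous_on UNIV ((*v) A)"
    by (simp add: linear_continuous_on matrix_vector_mul_bounded_linear)
  then have [measurable]: "(*v) A \<in> borel_measurable borel"
    by (rule borel_measurable_continuous_onI)
  have Y_borel[measurable]: "Y \<in> borel_measurable M"
    using distributed_measurable[OF Y] by simp
  have "distr M borel (\<lambda>\<omega>. ?T (Y \<omega>)) = distr (distr M lborel Y) borel ?T"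
    by (subst distr_distr) (simp_all add: o_def)
  also have "\<dots> = distr (density lborel (\<lambda>y. ?K * ?h (?T y))) borel ?T"
    unfolding distributed_distr_eq_density[OF Y] se_density_isometry[OF iso, abs_def] ..
  also have "\<dots> = density (distr lborel borel ?T) (\<lambda>z. ?K * ?h z)"
    by (subst density_distr) simp_all
  also have "\<dots> = density lborel (\<lambda>z. (c * ?K) * ?h z)"
    unfolding c by (subst density_density_eq) (simp_all add: mult.assoc)
  finally have law: "distr M borel (\<lambda>\<omega>. ?T (Y \<omega>)) = density lborel (\<lambda>z. (c * ?K) * ?h z)" .
  \<comment> \<open>both this law and the standard density have total mass 1, which determines \<open>c * ?K\<close>\<close>
  have half: "2 * (\<integral>\<^sup>+z. ?h z \<partial>lborel) = 1"
    using nn_integral_half_line_mass[OF g, of "se_alpha (mat 1) ?\<delta>"] by (simp add: nn_integral_cmult)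
  have "prob_space (distr M borel (\<lambda>\<omega>. ?T (Y \<omega>)))"
    by (rule prob_space_distr) simp
  from prob_space.emeasure_space_1[OF this]
  have "(c * ?K) * (\<integral>\<^sup>+z. ?h z \<partial>lborel) = 1"
    unfolding law by (simp add: emeasure_density nn_integral_cmult)
  then have cK: "c * ?K = 2"
    by (metis half mult.assoc mult.commute mult_1)
  have "distributed M lborel (\<lambda>\<omega>. ?T (Y \<omega>)) (se_density 0 (mat 1) ?\<delta> g)"
    unfolding distributed_def
  proof (intro conjI)
    show "distr M lborel (\<lambda>\<omega>. ?T (Y \<omega>)) = density lborel (se_density 0 (mat 1) ?\<delta> g)"
      using law[unfolded cK] by (simp add: se_density_standard[abs_def] cong: distr_cong)
  qed (simp_all add: se_density_standard[abs_def])
  then have "skew_elliptical M (\<lambda>\<omega>. ?T (Y \<omega>)) 0 (mat 1) ?\<delta> g"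
    using \<delta> g iso[of \<delta> \<delta>]
    by (simp add: skew_elliptical_def symmetric_pos_def_mat_1 matrix_inv_mat_1)
  moreover have "card {j. ?\<delta> $ j \<noteq> 0} \<le> card {first}"
    unfolding A\<delta> by (intro card_mono) (auto simp: axis_def)
  ultimately show ?thesis
    using A\<delta> by (intro exI[of _ A] exI[of _ ?\<delta>]) (simp add: s_def)
qed

end
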